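(* Let $\alpha,\beta,\gamma,\delta>-1$ and let $P_{n,k}^{(\alpha,\beta,\gamma,\delta)}(x,y)=P^{(\alpha,\beta)}_{n-k}(x)P^{(\gamma,\delta)}_{k}(y)$, $0\le k\le n$, be the orthogonal polynomials on the square. For $k\geq 0$ and $n\geq k+1$, $$\frac{\partial P_{n,k}^{(\alpha,\beta,\gamma,\delta)}(x,y)}{\partial\alpha}=\sum_{s=0}^{n-k-1}\frac{1}{n-k+s+\alpha+\beta+1}P_{n,k}^{(\alpha,\beta,\gamma,\delta)}(x,y)+\sum_{s=0}^{n-k-1} \frac{(\alpha+\beta+2n-2k-2s-1)(\beta+n-k-s)_{s+1}}{(s+1)(\alpha+\beta+2n-2k-s)(\alpha+\beta+n-k-s)_{s+1}}P_{n-s-1,k}^{(\alpha,\beta,\gamma,\delta)}(x,y),$$ $$\frac{\partial P_{n,k}^{(\alpha,\beta,\gamma,\delta)}(x,y)}{\partial\beta}=\sum_{s=0}^{n-k-1}\frac{1}{n-k+s+\alpha+\beta+1}P_{n,k}^{(\alpha,\beta,\gamma,\delta)}(x,y)+\sum_{s=0}^{n-k-1} \frac{(-1)^{n-k-s}(\alpha+\beta+2n-2k-2s-1)(\alpha+n-k-s)_{s+1}}{(s+1)(\alpha+\beta+2n-2k-s)(\alpha+\beta+n-k-s)_{s+1}}P_{n-s-1,k}^{(\alpha,\beta,\gamma,\delta)}(x,y),$$ and for $n=k\geq 0$, $$\frac{\partial P_{n,n}^{(\alpha,\beta,\gamma,\delta)}(x,y)}{\partial\alpha}=\frac{\partial P_{n,n}^{(\alpha,\beta,\gamma,\delta)}(x,y)}{\partial\beta}=0.$$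 For $n\geq k\geq 1$, $$\frac{\partial P_{n,k}^{(\alpha,\beta,\gamma,\delta)}(x,y)}{\partial\gamma}=\sum_{s=0}^{k-1}\frac{1}{\gamma+\delta+k+s+1}P_{n,k}^{(\alpha,\beta,\gamma,\delta)}(x,y)+\sum_{s=0}^{k-1} \frac{(\gamma+\delta+2k-2s-1)(\delta+k-s)_{s+1}}{(s+1)(\gamma+\delta+2k-s)(\gamma+\delta+k-s)_{s+1}}P_{n-s-1,k-s-1}^{(\alpha,\beta,\gamma,\delta)}(x,y),$$ $$\frac{\partial P_{n,k}^{(\alpha,\beta,\gamma,\delta)}(x,y)}{\partial\delta}=\sum_{s=0}^{k-1}\frac{1}{\gamma+\delta+k+s+1}P_{n,k}^{(\alpha,\beta,\gamma,\delta)}(x,y)+\sum_{s=0}^{k-1} \frac{(-1)^{k-s}(\gamma+\delta+2k-2s-1)(\gamma+k-s)_{s+1}}{(s+1)(\gamma+\delta+2k-s)(\gamma+\delta+k-s)_{s+1}}P_{n-s-1,k-s-1}^{(\alpha,\beta,\gamma,\delta)}(x,y),$$ and for $n\geq 0$, $k=0$, $$\frac{\partial P_{n,0}^{(\alpha,\beta,\gamma,\delta)}(x,y)}{\partial\gamma}=\frac{\partial P_{n,0}^{(\alpha,\beta,\gamma,\delta)}(x,y)}{\partial\delta}=0.$$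
   Context: The classical Jacobi polynomials are $P_{n}^{(a,b)}(x)=\frac{(-1)^{n}}{2^{n}n!}(1-x)^{-a}(1+x)^{-b}\frac{d^{n}}{dx^{n}}\{(1-x)^{n+a}(1+x)^{n+b}\}$. The Pochhammer symbol is $(a)_0=1$, $(a)_k=a(a+1)\cdots(a+k-1)$ for $k\ge1$. The square is $\{(x,y): -1\le x\le 1,\ -1\le y\le 1\}$, and orthogonality there is with respect to the weight $(1-x)^{\alpha}(1+x)^{\beta}(1-y)^{\gamma}(1+y)^{\delta}$.
   Formalization: The printed signs (-1)^{n-k-s} and (-1)^{k-s} in the β- and δ-formulas are false for even n-k or k and are replaced by (-1)^{s+1}; when α+β=-1 or γ+δ=-1 the last coefficient, printed as 0/0, is read as its limit (common factor cancelled). *)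

theory Defs
  imports "HOL-Analysis.Analysis" "HOL-Computational_Algebra.Polynomial"
begin

section \<open>Jacobi polynomials\<close>

definition rodrigues :: "nat \<Rightarrow> real \<Rightarrow> real \<Rightarrow> real \<Rightarrow> real" where
  "rodrigues n a b x =
     (-1) ^ n / (2 ^ n * fact n) * (1 - x) powr (- a) * (1 + x) powr (- b) *
     (deriv ^^ n) (\<lambda>t. (1 - t) powr (real n + a) * (1 + t) powr (real n + b)) x"

text \<open>
  The Rodrigues expression with real exponents is meaningful only for \<open>-1 < x < 1\<close>, where it
  agrees with a unique polynomial (see \<open>jacobi_poly_eqI\<close> and \<open>poly_jacobi_poly\<close> below).
  Taking that polynomial gives the values at the endpoints and at all other reals.
\<close>

definition jacobi_poly :: "nat \<Rightarrow> real \<Rightarrow> real \<Rightarrow> real poly" where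
  "jacobi_poly n a b = (THE p. \<forall>x\<in>{-1<..<1}. poly p x = rodrigues n a b x)"

definition jacobi_square ::
    "nat \<Rightarrow> nat \<Rightarrow> real \<Rightarrow> real \<Rightarrow> real \<Rightarrow> real \<Rightarrow> real \<Rightarrow> real \<Rightarrow> real" where
  "jacobi_square n k \<alpha> \<beta> \<gamma> \<delta> x y =
     poly (jacobi_poly (n - k) \<alpha> \<beta>) x * poly (jacobi_poly k \<gamma> \<delta>) y"

lemma poly_eq_on_interval:
  fixes p q :: "real poly"
  assumes "\<forall>x\<in>{-1<..<1}. poly p x = poly q x"
  shows "p = q"
proof (rule ccontr)
  assume "p \<noteq> q"
  then have "finite {x. poly (p - q) x = 0}"
    using poly_roots_finite[of "p - q"] by simp
  moreover have "{-1<..<1} \<subseteq> {x. poly (p - q) x = 0}"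
    using assms by auto
  ultimately have "finite {-1<..<(1::real)}"
    by (rule finite_subset[rotated])
  then show False by (simp add: infinite_Ioo)
qed

lemma deriv_funpow_weight:
  fixes c d :: real
  shows "\<exists>q :: real poly. \<forall>x\<in>{-1<..<1}.
    (deriv ^^ j) (\<lambda>t. (1 - t) powr c * (1 + t) powr d) x =
    poly q x * ((1 - x) powr (c - real j) * (1 + x) powr (d - real j))"
proof (induction j)
  case 0
  show ?case by (rule exI[of _ 1]) simp
next
  case (Suc j)
  let ?g = "(deriv ^^ j) (\<lambda>t. (1 - t) powr c * (1 + t) powr d)"
  let ?u = "c - real j" and ?v = "d - real j"
  obtain q :: "real poly" where q: "\<forall>x\<in>{-1<..<1}.
      ?g x = poly q x * ((1 - x) powr ?u * (1 + x) powr ?v)"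
    using Suc by blast
  define r where "r = pderiv q * [:1, 0, -1:] - smult ?u (q * [:1, 1:]) + smult ?v (q * [:1, -1:])"
  have "deriv ?g x = poly r x * ((1 - x) powr (?u - 1) * (1 + x) powr (?v - 1))"
    if x: "x \<in> {-1<..<1}" for x
  proof -
    let ?D = "poly (pderiv q) x * ((1 - x) powr ?u * (1 + x) powr ?v) +
      poly q x * (- ?u * (1 - x) powr (?u - 1) * (1 + x) powr ?v +
        (1 - x) powr ?u * (?v * (1 + x) powr (?v - 1)))"
    have "((\<lambda>t. poly q t * ((1 - t) powr ?u * (1 + t) powr ?v)) has_real_derivative ?D) (at x)"
      using x by (auto intro!: derivative_eq_intros simp: algebra_simps)
    then have "(?g has_real_derivative ?D) (at x)"
      by (rule has_field_derivative_transform_within_open[of _ _ _ "{-1<..<1}"]) (use q x in auto)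
    then have "deriv ?g x = ?D"
      by (rule DERIV_imp_deriv)
    also have "(1 - x) powr ?u = (1 - x) powr (?u - 1) * (1 - x)"
      using x powr_add[of "1 - x" "?u - 1" 1] by simp
    also have "(1 + x) powr ?v = (1 + x) powr (?v - 1) * (1 + x)"
      using x powr_add[of "1 + x" "?v - 1" 1] by simp
    finally show ?thesis
      by (simp add: r_def algebra_simps)
  qed
  then show ?case
    by (intro exI[of _ r]) (simp add: algebra_simps)
qed

lemma rodrigues_polynomial:
  "\<exists>p. \<forall>x\<in>{-1<..<1}. poly p x = rodrigues n a b x"
proof -
  obtain q :: "real poly" where q: "\<forall>x\<in>{-1<..<1}.
    (deriv ^^ n) (\<lambda>t. (1 - t) powr (real n + a) * (1 + t) powr (real n + b)) x =
    poly q x * ((1 - x) powr a * (1 + x) powr b)"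
    using deriv_funpow_weight[of n "real n + a" "real n + b"] by auto
  have "poly (smult ((-1) ^ n / (2 ^ n * fact n)) q) x = rodrigues n a b x"
    if x: "x \<in> {-1<..<1}" for x
    using x q by (simp add: rodrigues_def powr_minus field_simps)
  then show ?thesis by blast
qed

lemma jacobi_poly_eqI:
  assumes "\<forall>x\<in>{-1<..<1}. poly p x = rodrigues n a b x"
  shows "jacobi_poly n a b = p"
  unfolding jacobi_poly_def
  using assms by (intro the_equality) (auto intro: poly_eq_on_interval)

lemma poly_jacobi_poly:
  assumes "-1 < x" "x < 1"
  shows "poly (jacobi_poly n a b) x = rodrigues n a b x"
proof -
  obtain p where p: "\<forall>x\<in>{-1<..<1}. poly p x = rodrigues n a b x"
    using rodrigues_polynomial by blast
  with assms jacobi_poly_eqI[OF p] show ?thesis by simp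
qed


section \<open>Connection coefficients\<close>

definition jacobi_quot :: "real \<Rightarrow> real \<Rightarrow> nat \<Rightarrow> nat \<Rightarrow> real" where
  "jacobi_quot a b m s =
     (a + b + 2 * real m - 2 * real s - 1) * pochhammer (b + real m - real s) (s + 1) /
     ((real s + 1) * (a + b + 2 * real m - real s) * pochhammer (a + b + real m - real s) (s + 1))"

text \<open>
  For \<open>a, b > -1\<close> and \<open>s < m\<close> the quotient is of the form \<open>0 / 0\<close> exactly when \<open>a + b = -1\<close> and
  \<open>s = m - 1\<close>: then the factor \<open>a + b + 1\<close> occurs in the numerator and as the first factor of the
  Pochhammer symbol in the denominator. The coefficient is understood with this common factor
  cancelled; the value below is the limit of the quotient (see \<open>tendsto_jacobi_coeff\<close>).

  For a derivative in the second parameter the coefficient occurs with \<open>a\<close> and \<open>b\<close> exchanged and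
  with the sign \<open>(-1) ^ (s + 1)\<close>, which comes from the reflection of the two degrees \<open>m\<close> and
  \<open>m - s - 1\<close> under \<open>x \<mapsto> -x\<close>.
\<close>

definition jacobi_coeff :: "real \<Rightarrow> real \<Rightarrow> nat \<Rightarrow> nat \<Rightarrow> real" where
  "jacobi_coeff a b m s =
     (if a + b = -1 \<and> m = s + 1 then pochhammer (b + 1) m / (real m * fact m)
      else jacobi_quot a b m s)"

lemma jacobi_coeff_last:
  "jacobi_coeff a b (s + 1) s =
    pochhammer (b + 1) (s + 1) /
      ((real s + 1) * ((a + b + real s + 2) * pochhammer (a + b + 2) s))"
proof (cases "a + b = -1")
  case True
  then have eqs: "a + b + real s + 2 = real s + 1" "a + b + 2 = 1" by auto
  show ?thesis
    unfolding eqs using True by (simp add: jacobi_coeff_def pochhammer_fact[symmetric] add.commute)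
next
  case False
  then have nz: "a + b + 1 \<noteq> 0" by auto
  let ?M = "(real s + 1) * ((a + b + real s + 2) * pochhammer (a + b + 2) s)"
  have ps: "pochhammer (a + b + 1) (s + 1) = (a + b + 1) * pochhammer (a + b + 2) s"
    by (simp add: pochhammer_rec add.assoc)
  have "jacobi_coeff a b (s + 1) s = jacobi_quot a b (s + 1) s"
    using False by (simp add: jacobi_coeff_def)
  also have "\<dots> = (a + b + 1) * pochhammer (b + 1) (s + 1) /
      ((real s + 1) * (a + b + real s + 2) * pochhammer (a + b + 1) (s + 1))"
  proof -
    have "a + b + 2 * real (s + 1) - 2 * real s - 1 = a + b + 1"
      "b + real (s + 1) - real s = b + 1"
      "a + b + 2 * real (s + 1) - real s = a + b + real s + 2"
      "a + b + real (s + 1) - real s = a + b + 1" by simp_all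
    then show ?thesis unfolding jacobi_quot_def by (simp only:)
  qed
  also have "\<dots> = (a + b + 1) * pochhammer (b + 1) (s + 1) / ((a + b + 1) * ?M)"
    unfolding ps by (simp only: mult.assoc mult.left_commute)
  also have "\<dots> = pochhammer (b + 1) (s + 1) / ?M"
    by (rule mult_divide_mult_cancel_left[OF nz])
  finally show ?thesis .
qed

lemma tendsto_jacobi_coeff:
  assumes "a > -1" "b > -1" "s < m"
  shows "((\<lambda>t. jacobi_quot t b m s) \<longlongrightarrow> jacobi_coeff a b m s) (at a)"
proof (cases "m = s + 1")
  case True
  have "a + b + 2 + real i \<noteq> 0" for i
    using assms by linarith
  moreover have "a + b + real s + 2 \<noteq> 0"
    using assms by linarith
  ultimately have "isCont (\<lambda>t. jacobi_coeff t b (s + 1) s) a"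
    unfolding jacobi_coeff_last pochhammer_prod by (intro continuous_intros) auto
  then have "((\<lambda>t. jacobi_coeff t b m s) \<longlongrightarrow> jacobi_coeff a b m s) (at a)"
    unfolding True isCont_def .
  moreover have "\<forall>\<^sub>F t in at a. jacobi_coeff t b m s = jacobi_quot t b m s"
  proof -
    have "\<forall>\<^sub>F t in at a. t \<noteq> -1 - b"
      by (rule eventually_neq_at_within)
    then show ?thesis
      by eventually_elim (auto simp: jacobi_coeff_def)
  qed
  ultimately show ?thesis by (rule Lim_transform_eventually)
next
  case False
  then have "real m \<ge> real s + 2" using assms by linarith
  then have "a + b + real m - real s + real i \<noteq> 0" for i
    using assms by linarith
  moreover have "a + b + 2 * real m - real s \<noteq> 0"
    using assms \<open>real m \<ge> real s + 2\<close> by linarith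
  ultimately have "(real s + 1) * (a + b + 2 * real m - real s) *
      pochhammer (a + b + real m - real s) (s + 1) \<noteq> 0"
    by (simp only: pochhammer_prod mult_eq_0_iff prod_zero_iff finite_atLeastLessThan) auto
  then have "isCont (\<lambda>t. jacobi_quot t b m s) a"
    unfolding jacobi_quot_def by (intro isCont_divide) (auto simp only: pochhammer_prod intro!: continuous_intros)
  with False show ?thesis
    by (simp add: isCont_def jacobi_coeff_def)
qed

end

theory Submission
  imports Defs
begin

text \<open>
  Since \<open>jacobi_square\<close> is a product of two Jacobi polynomials in separate variables, each
  claim is a statement about the parameter derivatives of a single \<open>P\<^sub>m\<^bsup>(a,b)\<^esup>\<close>. For \<open>m = 0\<close> they
  vanish because \<open>P\<^sub>0 = 1\<close>; let \<open>m \<ge> 1\<close>.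

  In powers of \<open>u = (1 + x) / 2\<close> the coefficients of \<open>P\<^sub>m\<^bsup>(a,b)\<^esup>\<close> depend on \<open>a\<close> only through the
  Pochhammer symbol \<open>(m + a + b + 1)\<^sub>j\<close>, so \<open>\<partial>/\<partial>a\<close> multiplies the coefficient of \<open>u\<^sup>j\<close> by the
  logarithmic derivative \<open>H\<^sub>j = (\<Sum>i<j. 1 / (m + a + b + 1 + i))\<close>. The first sum of the claim is
  \<open>H\<^sub>m P\<^sub>m\<close>. It remains to see that the polynomial with coefficients \<open>H\<^sub>j - H\<^sub>m\<close> times those of
  \<open>P\<^sub>m\<close> is the stated combination of \<open>P\<^sub>0, \<dots>, P\<^bsub>m-1\<^esub>\<close>
  (\<open>jacobi_shifted_coeff_connection\<close>).

  Comparing coefficients of \<open>u\<^sup>j\<close>, the Pochhammer symbols of \<open>b\<close> cancel, so that only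
  \<open>a + b\<close> is left, and with \<open>N = m - j\<close> and \<open>r = - (a + b + 1 + 2 j)\<close> what remains to be shown is
  \<open>(\<Sum>i<N. (r gchoose i) * (1 / (N - i) - 1 / (N - r + i)))
    = - (r gchoose N) * (\<Sum>i<N. 1 / (N - r + i))\<close>.
  After clearing denominators both sides are polynomials in \<open>r\<close> of degree below \<open>2 N\<close>, and they
  agree at \<open>r = 0, \<dots>, 2 N - 1\<close>, in each case by the symmetry of the binomial coefficients
  (\<open>sum_gbinomial_diff_inverse\<close>). The reduction divides by \<open>r gchoose N\<close>, which vanishes when
  \<open>a + b = -1\<close> and \<open>j = 0\<close>; that case follows by continuity in \<open>a\<close>.

  The derivative in the second parameter is obtained from the first one through the reflection
  \<open>P\<^sub>m\<^bsup>(a,b)\<^esup>(-x) = (-1)\<^sup>m P\<^sub>m\<^bsup>(b,a)\<^esup>(x)\<close>. Both the reflection and the expansion in \<open>u\<close> are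
  proved by induction on the degree from the recursion \<open>jacobi_poly_Suc\<close>, which is one
  differentiation in Rodrigues' formula.
\<close>

section \<open>Recursion and reflection\<close>

lemma jacobi_poly_0: "jacobi_poly 0 a b = 1"
  by (rule jacobi_poly_eqI) (auto simp: rodrigues_def powr_minus field_simps)

text \<open>
  The weight \<open>(1 - t) powr (n + 1 + a) * (1 + t) powr (n + 1 + b)\<close> of degree \<open>n + 1\<close> for \<open>(a, b)\<close>
  is the weight of degree \<open>n\<close> for \<open>(a + 1, b + 1)\<close>. Its \<open>n\<close>-th derivative is thus known, and one
  more differentiation raises the degree by one while lowering both parameters by one.
\<close>

lemma jacobi_poly_Suc:
  "jacobi_poly (Suc n) a b = smult (-1 / (2 * real (Suc n)))
     ([:1, 0, -1:] * pderiv (jacobi_poly n (a + 1) (b + 1))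
       + [:b - a, - (a + b + 2):] * jacobi_poly n (a + 1) (b + 1))"
proof (rule jacobi_poly_eqI, intro ballI)
  fix x :: real
  assume x: "x \<in> {-1<..<1}"
  define p where "p = jacobi_poly n (a + 1) (b + 1)"
  define C where "C = (-1) ^ n * 2 ^ n * (fact n :: real)"
  let ?f = "\<lambda>t. (1 - t) powr (real (Suc n) + a) * (1 + t) powr (real (Suc n) + b)"
  let ?D = "C * (poly (pderiv p) x * ((1 - x) powr (a + 1) * (1 + x) powr (b + 1)) +
      poly p x * (- (a + 1) * (1 - x) powr a * (1 + x) powr (b + 1) +
        (1 - x) powr (a + 1) * ((b + 1) * (1 + x) powr b)))"
  have deriv_n: "(deriv ^^ n) ?f t = C * (poly p t * ((1 - t) powr (a + 1) * (1 + t) powr (b + 1)))"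
    if "t \<in> {-1<..<1}" for t
  proof -
    have exps: "real (Suc n) + a = real n + (a + 1)" "real (Suc n) + b = real n + (b + 1)"
      by simp_all
    define A where "A = (1 - t) powr (a + 1)"
    define B where "B = (1 + t) powr (b + 1)"
    have "A \<noteq> 0" "B \<noteq> 0" using that by (auto simp: A_def B_def)
    have "poly p t = rodrigues n (a + 1) (b + 1) t"
      unfolding p_def using that by (intro poly_jacobi_poly) auto
    also have "\<dots> = (-1) ^ n / (2 ^ n * fact n) * inverse A * inverse B * (deriv ^^ n) ?f t"
      unfolding rodrigues_def powr_minus exps A_def B_def ..
    finally have "C * (poly p t * (A * B)) = ((-1) ^ n * (-1) ^ n) * (deriv ^^ n) ?f t"
      using \<open>A \<noteq> 0\<close> \<open>B \<noteq> 0\<close> unfolding C_def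
      by (simp only: field_simps) (simp add: field_simps)
    then show ?thesis
      by (simp add: A_def B_def flip: power_mult_distrib)
  qed
  have "((\<lambda>t. C * (poly p t * ((1 - t) powr (a + 1) * (1 + t) powr (b + 1)))) has_real_derivative ?D) (at x)"
    using x by (auto intro!: derivative_eq_intros simp: algebra_simps)
  then have "((deriv ^^ n) ?f has_real_derivative ?D) (at x)"
    by (rule has_field_derivative_transform_within_open[of _ _ _ "{-1<..<1}"]) (use deriv_n x in auto)
  then have D: "(deriv ^^ Suc n) ?f x = ?D"
    by (auto intro: DERIV_imp_deriv)
  have pw: "(1 - x) powr (a + 1) = (1 - x) powr a * (1 - x)" "(1 + x) powr (b + 1) = (1 + x) powr b * (1 + x)"
    using x by (simp_all add: powr_add)
  have nz: "(1 - x) powr a \<noteq> 0" "(1 + x) powr b \<noteq> 0"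
    using x by auto
  define A where "A = (1 - x) powr a"
  define B where "B = (1 + x) powr b"
  define E where "E = (1 - x\<^sup>2) * poly (pderiv p) x + (b - a - (a + b + 2) * x) * poly p x"
  have "?D = C * E * (A * B)"
    unfolding pw A_def[symmetric] B_def[symmetric] E_def by (simp add: algebra_simps power2_eq_square)
  then have "rodrigues (Suc n) a b x =
      (-1) ^ Suc n / (2 ^ Suc n * fact (Suc n)) * inverse A * inverse B * (C * E * (A * B))"
    unfolding rodrigues_def D powr_minus A_def B_def by (simp only:)
  also have "\<dots> = (-1) ^ Suc n / (2 ^ Suc n * fact (Suc n)) * C * E * ((inverse A * A) * (inverse B * B))"
    by (simp only: mult_ac)
  also have "\<dots> = (-1) ^ Suc n / (2 ^ Suc n * fact (Suc n)) * C * E"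
    using nz unfolding A_def[symmetric] B_def[symmetric] by simp
  also have "(-1) ^ Suc n / (2 ^ Suc n * fact (Suc n)) * C = -1 / (2 * real (Suc n))"
    by (simp add: C_def divide_simps del: of_nat_Suc)
  finally show "poly (smult (-1 / (2 * real (Suc n))) ([:1, 0, -1:] * pderiv (jacobi_poly n (a + 1) (b + 1))
       + [:b - a, - (a + b + 2):] * jacobi_poly n (a + 1) (b + 1))) x = rodrigues (Suc n) a b x"
    by (simp add: p_def E_def algebra_simps power2_eq_square)
qed

lemma jacobi_poly_reflect:
  "jacobi_poly n a b \<circ>\<^sub>p [:0, -1:] = smult ((-1) ^ n) (jacobi_poly n b a)"
proof (induction n arbitrary: a b)
  case 0
  then show ?case by (simp add: jacobi_poly_0 pcompose_1)
next
  case (Suc n)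
  let ?p = "jacobi_poly n (a + 1) (b + 1)" and ?q = "jacobi_poly n (b + 1) (a + 1)"
  have "pderiv (?p \<circ>\<^sub>p [:0, -1:]) = smult ((-1) ^ n) (pderiv ?q)"
    by (simp add: Suc pderiv_smult)
  then have d: "pderiv ?p \<circ>\<^sub>p [:0, -1:] = smult (- ((-1) ^ n)) (pderiv ?q)"
    by (simp add: pderiv_pcompose pderiv_pCons minus_equation_iff[of _ "smult _ _"])
  have "poly (jacobi_poly (Suc n) a b) (- x) = (-1) ^ Suc n * poly (jacobi_poly (Suc n) b a) x" for x
    using arg_cong[OF Suc[of "a + 1" "b + 1"], of "\<lambda>p. poly p x"] arg_cong[OF d, of "\<lambda>p. poly p x"]
    unfolding jacobi_poly_Suc by (simp add: poly_pcompose field_simps)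
  then show ?case
    by (subst poly_eq_poly_eq_iff[symmetric]) (simp add: fun_eq_iff poly_pcompose)
qed

section \<open>Expansion in powers of \<open>(1 + x) / 2\<close>\<close>

text \<open>
  The more common expansion around \<open>x = 1\<close> involves \<open>a\<close> twice. Around \<open>x = -1\<close> the roles of \<open>a\<close> and \<open>b\<close> are
  exchanged, and \<open>a\<close> occurs in the last factor only. The factor \<open>n choose j\<close> makes the
  coefficients with \<open>j > n\<close> vanish.
\<close>

definition jacobi_shifted_coeff :: "nat \<Rightarrow> real \<Rightarrow> real \<Rightarrow> nat \<Rightarrow> real" where
  "jacobi_shifted_coeff n a b j =
     (-1) ^ (n + j) / fact n * real (n choose j) *
     pochhammer (b + real j + 1) (n - j) * pochhammer (real n + a + b + 1) j"

definition jacobi_shifted :: "nat \<Rightarrow> real \<Rightarrow> real \<Rightarrow> real poly" where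
  "jacobi_shifted n a b = (\<Sum>j\<le>n. monom (jacobi_shifted_coeff n a b j) j)"

lemma jacobi_shifted_coeff_eq_0: "n < j \<Longrightarrow> jacobi_shifted_coeff n a b j = 0"
  by (simp add: jacobi_shifted_coeff_def)

lemma coeff_jacobi_shifted: "coeff (jacobi_shifted n a b) j = jacobi_shifted_coeff n a b j"
  by (auto simp: jacobi_shifted_def coeff_sum jacobi_shifted_coeff_eq_0)

text \<open>
  The recursion \<open>jacobi_poly_Suc\<close> on the level of coefficients. Up to common factors it is the
  identity \<open>(n + 1 - j) (n + c + 2 + j) + j (c + j + 1) = (n + 1) (n + c + 2)\<close> with \<open>c = a + b\<close>;
  in the proof, \<open>c1\<close> and \<open>c2\<close> put the binomial coefficients over the common one, and
  \<open>e1\<close>, \<open>e2\<close>, \<open>e3\<close> split off the common factor \<open>S * B * pochhammer y i\<close>.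
\<close>

lemma jacobi_shifted_coeff_Suc:
  "(real j + b + 1) * jacobi_shifted_coeff n (a + 1) (b + 1) j
     - (if j = 0 then 0 else (real j + a + b + 1) * jacobi_shifted_coeff n (a + 1) (b + 1) (j - 1))
   = - real (Suc n) * jacobi_shifted_coeff (Suc n) a b j"
proof (cases j)
  case 0
  have "pochhammer (b + 1) (Suc n) = (b + 1) * pochhammer (b + 2) n"
    by (simp add: pochhammer_rec add.assoc)
  moreover have "real (Suc n) * ((-1) ^ Suc n / fact (Suc n)) = - ((-1) ^ n / fact n)"
    by (simp add: divide_simps del: of_nat_Suc)
  moreover have "- real (Suc n) * jacobi_shifted_coeff (Suc n) a b 0 =
      - (real (Suc n) * ((-1) ^ Suc n / fact (Suc n))) * pochhammer (b + 1) (Suc n)"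
    by (simp add: jacobi_shifted_coeff_def del: pochhammer_Suc fact_Suc of_nat_Suc)
  ultimately show ?thesis
    using 0 by (simp add: jacobi_shifted_coeff_def add.assoc del: pochhammer_Suc fact_Suc of_nat_Suc)
next
  case (Suc i)
  show ?thesis
  proof (cases "i \<le> n")
    case False
    with Suc show ?thesis by (simp add: jacobi_shifted_coeff_eq_0)
  next
    case True
    define y where "y = real n + a + b + 3"
    define B where "B = pochhammer (b + real i + 2) (n - i)"
    define S where "S = ((-1) ^ (n + i) :: real) / fact n"
    have c1: "real (Suc n) * real (n choose i) = real (Suc i) * real (Suc n choose Suc i)"
      using Suc_times_binomial_eq[of n i] by (simp only: of_nat_mult[symmetric] mult.commute)
    have c2: "real (Suc n) * real (n choose Suc i) = (real n - real i) * real (Suc n choose Suc i)"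
    proof (cases "Suc i \<le> n")
      case True
      have "real (n choose Suc i) + real (n choose i) = real (Suc n choose Suc i)" by simp
      with c1 show ?thesis by (simp add: algebra_simps)
    next
      case False
      with \<open>i \<le> n\<close> have "i = n" by simp
      then show ?thesis by simp
    qed
    have e1: "(real j + b + 1) * jacobi_shifted_coeff n (a + 1) (b + 1) j =
       - S * real (n choose Suc i) * B * (pochhammer y i * (y + real i))"
    proof (cases "Suc i \<le> n")
      case True
      then have "n - i = Suc (n - Suc i)" by simp
      then have "B = (b + real i + 2) * pochhammer (b + real i + 3) (n - Suc i)"
        by (simp add: B_def pochhammer_rec add.assoc)
      then show ?thesis
        using Suc by (simp add: jacobi_shifted_coeff_def S_def y_def pochhammer_Suc field_simps)
    qed (use Suc in \<open>simp add: jacobi_shifted_coeff_def binomial_eq_0\<close>)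
    have e2: "jacobi_shifted_coeff n (a + 1) (b + 1) (j - 1) = S * real (n choose i) * B * pochhammer y i"
      using Suc by (simp add: jacobi_shifted_coeff_def S_def y_def B_def algebra_simps)
    have B': "pochhammer (b + real (Suc i) + 1) (Suc n - Suc i) = B"
      by (simp add: B_def algebra_simps)
    have Y': "pochhammer (real (Suc n) + a + b + 1) (Suc i) = (y - 1) * pochhammer y i"
      by (simp add: y_def pochhammer_rec algebra_simps)
    have S': "real (Suc n) * ((-1) ^ (Suc n + Suc i) / fact (Suc n)) = S"
      by (simp add: S_def divide_simps del: of_nat_Suc)
    have e3: "real (Suc n) * jacobi_shifted_coeff (Suc n) a b j =
      S * real (Suc n choose Suc i) * B * ((y - 1) * pochhammer y i)"
      unfolding jacobi_shifted_coeff_def Suc B' Y' S'[symmetric] by (simp only: mult.assoc)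
    have e4: "real j + a + b + 1 = y + real i - real n - 1"
      using Suc by (simp add: y_def)
    define K where "K = real (Suc n choose Suc i)"
    have "real (Suc n) * (real (n choose Suc i) * (y + real i) + (y + real i - real n - 1) * real (n choose i))
        = (real (Suc n) * real (n choose Suc i)) * (y + real i)
          + (y + real i - real n - 1) * (real (Suc n) * real (n choose i))"
      by (simp only: algebra_simps)
    also have "\<dots> = real (Suc n) * (K * (y - 1))"
      unfolding c1 c2 K_def[symmetric] by (simp add: algebra_simps)
    finally have "real (n choose Suc i) * (y + real i) + (y + real i - real n - 1) * real (n choose i) = K * (y - 1)"
      by (simp only: mult_cancel_left of_nat_eq_0_iff nat.simps simp_thms)
    then have "- S * B * pochhammer y i *
        (real (n choose Suc i) * (y + real i) + (y + real i - real n - 1) * real (n choose i))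
        = - S * B * pochhammer y i * (K * (y - 1))"
      by (simp only:)
    then show ?thesis
      using Suc e3 unfolding e1 e2 e4 K_def by (simp add: algebra_simps del: binomial_Suc_Suc)
  qed
qed

text \<open>
  In the variable \<open>u = (1 + x) / 2\<close> one has \<open>1 - x\<^sup>2 = 4 u (1 - u)\<close> and \<open>d/dx = 1/2 d/du\<close>, which
  turns the right-hand side of \<open>jacobi_poly_Suc\<close> into the left-hand side below, up to a constant.
\<close>

lemma jacobi_shifted_Suc:
  "[:0, 1, -1:] * pderiv (jacobi_shifted n (a + 1) (b + 1))
     + [:b + 1, - (a + b + 2):] * jacobi_shifted n (a + 1) (b + 1)
   = smult (- real (Suc n)) (jacobi_shifted (Suc n) a b)" (is "?L = ?R")
proof (rule poly_eqI)
  fix j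
  have "coeff ?L j = (real j + b + 1) * jacobi_shifted_coeff n (a + 1) (b + 1) j
     - (if j = 0 then 0 else (real j + a + b + 1) * jacobi_shifted_coeff n (a + 1) (b + 1) (j - 1))"
  proof (cases j)
    case (Suc i)
    then show ?thesis
      by (cases i) (simp_all add: coeff_pderiv coeff_jacobi_shifted algebra_simps)
  qed (simp add: coeff_jacobi_shifted)
  then show "coeff ?L j = coeff ?R j"
    unfolding jacobi_shifted_coeff_Suc by (simp add: coeff_jacobi_shifted)
qed

lemma jacobi_poly_eq_pcompose_shifted:
  "jacobi_poly n a b = jacobi_shifted n a b \<circ>\<^sub>p [:1/2, 1/2:]"
proof (induction n arbitrary: a b)
  case 0
  then show ?case
    by (simp add: jacobi_poly_0 jacobi_shifted_def jacobi_shifted_coeff_def pcompose_1 monom_0 one_pCons)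
next
  case (Suc n)
  let ?U = "jacobi_shifted n (a + 1) (b + 1)"
  have "poly (jacobi_poly (Suc n) a b) x = poly (jacobi_shifted (Suc n) a b) ((1 + x) / 2)" for x
  proof -
    define u where "u = (1 + x) / 2"
    then have x: "x = 2 * u - 1" by simp
    have u2: "1 / 2 + x / 2 = u" by (simp add: u_def add_divide_distrib)
    have "u * (1 - u) * poly (pderiv ?U) u + (b + 1 - (a + b + 2) * u) * poly ?U u
        = - real (Suc n) * poly (jacobi_shifted (Suc n) a b) u"
      using arg_cong[OF jacobi_shifted_Suc[of n a b], of "\<lambda>p. poly p u"] by (simp add: algebra_simps)
    then have "poly (jacobi_shifted (Suc n) a b) u =
      -1 / real (Suc n) * (u * (1 - u) * poly (pderiv ?U) u + (b + 1 - (a + b + 2) * u) * poly ?U u)"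
      by (simp add: field_simps)
    moreover have "poly (jacobi_poly (Suc n) a b) x = -1 / real (Suc n) * (u * (1 - u) * poly (pderiv ?U) u + (b + 1 - (a + b + 2) * u) * poly ?U u)"
      unfolding jacobi_poly_Suc Suc using u2 x
      by (simp add: pderiv_pcompose pderiv_pCons poly_pcompose) (simp add: divide_simps, simp add: algebra_simps)
    ultimately show ?thesis unfolding u_def by simp
  qed
  then show ?case
    by (subst poly_eq_poly_eq_iff[symmetric]) (simp add: fun_eq_iff poly_pcompose add_divide_distrib)
qed

lemma poly_jacobi_poly_shifted:
  "poly (jacobi_poly n a b) x = (\<Sum>j\<le>n. jacobi_shifted_coeff n a b j * ((1 + x) / 2) ^ j)"
  by (simp add: jacobi_poly_eq_pcompose_shifted poly_pcompose jacobi_shifted_def poly_sum poly_monom add_divide_distrib)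

section \<open>A summation identity for generalised binomial coefficients\<close>

text \<open>
  Multiplying by \<open>(\<Prod>i<N. N - r + i)\<close> turns the difference of the two sides into a polynomial in
  \<open>r\<close> of degree at most \<open>2 N - 1\<close>. At an integer \<open>0 \<le> r < N\<close> the right-hand side is \<open>0\<close> and the
  left-hand side changes sign under \<open>i \<mapsto> r - i\<close>. At \<open>r = N + h\<close> with \<open>h < N\<close> only the terms with
  vanishing denominator \<open>N - r + h\<close> survive, and they cancel because
  \<open>N + h choose h = N + h choose N\<close>. These are \<open>2 N\<close> roots.
\<close>

lemma sum_gbinomial_diff_inverse:
  fixes r :: real
  assumes nz: "\<And>i. i < N \<Longrightarrow> real N - r + real i \<noteq> 0"
  shows "(\<Sum>i<N. (r gchoose i) * (1 / (real N - real i) - 1 / (real N - r + real i)))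
       = - (r gchoose N) * (\<Sum>i<N. 1 / (real N - r + real i))"
proof -
  define g :: "nat \<Rightarrow> real poly" where "g i = smult (1 / fact i) (\<Prod>l<i. [:- real l, 1:])" for i
  define V :: "nat set \<Rightarrow> real poly" where "V A = (\<Prod>l\<in>A. [:real (N + l), -1:])" for A
  define W where "W = V {..<N}"
  define W' where "W' i = V ({..<N} - {i})" for i
  (* W is the common denominator, W' i is W without its factor N - r + i, and G is the left-hand
     side minus the right-hand side, multiplied by W. *)
  define G where "G = (\<Sum>i<N. g i * (smult (1 / (real N - real i)) W - W' i)) + g N * (\<Sum>i<N. W' i)"
  have g: "poly (g i) x = x gchoose i" for i x
    by (simp add: g_def gbinomial_prod_rev poly_prod atLeast0LessThan)
  have V: "poly (V A) x = (\<Prod>l\<in>A. real N - x + real l)" for A x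
    by (simp add: V_def poly_prod algebra_simps)
  have WW': "poly W x = (real N - x + real i) * poly (W' i) x" if "i < N" for i x
    unfolding W_def W'_def V using that by (subst prod.remove[of _ i]) auto
  have deg_g: "degree (g i) \<le> i" for i
    unfolding g_def
    by (rule order.trans[OF degree_smult_le], rule order.trans[OF degree_prod_sum_le]) auto
  have deg_V: "degree (V A) \<le> card A" if "finite A" for A
    unfolding V_def using that
    by (intro order.trans[OF degree_prod_sum_le]) auto
  have "degree G < 2 * N" if "N > 0"
  proof -
    have "degree G \<le> 2 * N - 1"
      unfolding G_def
    proof (intro degree_add_le degree_sum_le)
      fix i assume i: "i \<in> {..<N}"
      have "degree W \<le> N" using deg_V[of "{..<N}"] by (simp add: W_def)
      moreover have "degree (W' i) \<le> N" using deg_V[of "{..<N} - {i}"] i by (simp add: W'_def)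
      ultimately have "degree (smult (1 / (real N - real i)) W - W' i) \<le> N"
        by (intro degree_diff_le order.trans[OF degree_smult_le])
      with deg_g[of i] i show "degree (g i * (smult (1 / (real N - real i)) W - W' i)) \<le> 2 * N - 1"
        by (intro order.trans[OF degree_mult_le]) auto
    next
      have "degree (\<Sum>i<N. W' i) \<le> N - 1"
      proof (rule degree_sum_le)
        fix i assume "i \<in> {..<N}"
        then show "degree (W' i) \<le> N - 1"
          using deg_V[of "{..<N} - {i}"] by (simp add: W'_def)
      qed simp
      with deg_g[of N] that show "degree (g N * (\<Sum>i<N. W' i)) \<le> 2 * N - 1"
        by (intro order.trans[OF degree_mult_le]) auto
    qed auto
    with that show ?thesis by simp
  qed
  moreover have root: "poly G (real q) = 0" if q: "q < 2 * N" for q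
  proof (cases "q < N")
    case True
    define w where "w = poly W (real q)"
    have W'q: "poly (W' i) (real q) = w / (real N - real q + real i)" if "i < N" for i
      using WW'[OF that, of "real q"] True by (simp add: w_def field_simps)
    have "poly G (real q) = (\<Sum>i<N. real (q choose i) * (w / (real N - real i) - w / (real N - real q + real i)))"
      using True by (auto simp: G_def poly_sum g w_def[symmetric] W'q binomial_gbinomial[symmetric] simp del: of_nat_diff intro!: sum.cong)
    also have "\<dots> = (\<Sum>i\<le>q. real (q choose i) * (w / (real N - real i) - w / (real N - real q + real i)))"
      using True by (intro sum.mono_neutral_right) auto
    also have "\<dots> = (\<Sum>i\<le>q. real (q choose i) * (w / (real N - real i)))
        - (\<Sum>i\<le>q. real (q choose i) * (w / (real N - real q + real i)))"
      by (simp add: right_diff_distrib sum_subtractf)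
    also have "(\<Sum>i\<le>q. real (q choose i) * (w / (real N - real i)))
        = (\<Sum>i\<le>q. real (q choose i) * (w / (real N - real q + real i)))"
      by (rule sum.reindex_bij_witness[of _ "\<lambda>i. q - i" "\<lambda>i. q - i"])
         (auto simp: binomial_symmetric[symmetric] of_nat_diff algebra_simps)
    finally show ?thesis by simp
  next
    case False
    define h where "h = q - N"
    have h: "h < N" "q = N + h" using False q by (auto simp: h_def)
    have W0: "poly W (real q) = 0"
      using WW'[OF h(1), of "real q"] h(2) by simp
    define v where "v = poly (W' h) (real q)"
    have W'0: "poly (W' i) (real q) = (if i = h then v else 0)" if "i < N" for i
      using WW'[OF that, of "real q"] W0 h(2) by (auto simp: v_def)
    have "poly G (real q) = (\<Sum>i<N. - (real (q choose i) * poly (W' i) (real q)))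
        + real (q choose N) * (\<Sum>i<N. poly (W' i) (real q))"
      by (simp add: G_def poly_sum g W0 binomial_gbinomial)
    also have "(\<Sum>i<N. - (real (q choose i) * poly (W' i) (real q))) = (\<Sum>i<N. if i = h then - (real (q choose h) * v) else 0)"
      by (intro sum.cong) (auto simp: W'0)
    also have "(\<Sum>i<N. poly (W' i) (real q)) = (\<Sum>i<N. if i = h then v else 0)"
      by (intro sum.cong) (auto simp: W'0)
    also have "(\<Sum>i<N. if i = h then - (real (q choose h) * v) else 0) + real (q choose N) * (\<Sum>i<N. if i = h then v else 0)
       = (real (q choose N) - real (q choose h)) * v"
      using h(1) by (simp add: left_diff_distrib)
    also have "q choose h = q choose N"
      using binomial_symmetric[of h q] h(2) by simp
    finally show ?thesis by simp
  qed
  ultimately have "G = 0"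
    by (cases "N = 0", simp add: G_def)
       (rule poly_eqI_degree[of "real ` {..<2 * N}"], auto simp: card_image)
  define w where "w = poly W r"
  have "w \<noteq> 0" using nz by (simp add: w_def W_def V)
  have W'r: "poly (W' i) r = w * (1 / (real N - r + real i))" if "i < N" for i
    using WW'[OF that, of r] nz[OF that] by (simp add: w_def)
  have "0 = poly G r" by (simp add: \<open>G = 0\<close>)
  also have "\<dots> = w * ((\<Sum>i<N. (r gchoose i) * (1 / (real N - real i) - 1 / (real N - r + real i)))
      + (r gchoose N) * (\<Sum>i<N. 1 / (real N - r + real i)))"
    by (simp add: G_def poly_sum g w_def[symmetric] W'r distrib_left sum_distrib_left del: of_nat_diff)
       (intro arg_cong2[where f = "(+)"] sum.cong, auto simp: algebra_simps)
  finally show ?thesis using \<open>w \<noteq> 0\<close> by (simp add: add_eq_0_iff)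
qed

section \<open>The connection identity for the coefficients\<close>

text \<open>
  This matches a single term of the connection sum (for \<open>m = j + N\<close> and \<open>m - s - 1 = j + i\<close>) with a
  single term of \<open>sum_gbinomial_diff_inverse\<close> at \<open>r = - d\<close>, where \<open>d = a + b + 1 + 2 j\<close>. The
  factor \<open>a + b + 2 m - 2 s - 1 = d + 2 i\<close> of the quotient appears because
  \<open>1 / (N - i) - 1 / (N + d + i) = (d + 2 i) / ((N - i) (N + d + i))\<close>. The rest splits
  Pochhammer symbols in two ways.
\<close>

lemma jacobi_shifted_coeff_ratio:
  fixes a b :: real
  assumes nz: "a + b > -2" "a + b \<noteq> -1" and "i < N"
  shows "jacobi_quot a b (j + N) (N - 1 - i) * jacobi_shifted_coeff (j + i) a b j *
      ((- (a + b + 1 + 2 * real j)) gchoose N)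
    = jacobi_shifted_coeff (j + N) a b j * (((- (a + b + 1 + 2 * real j)) gchoose i) *
      (1 / (real N - real i) - 1 / (real N + (a + b + 1 + 2 * real j) + real i)))"
proof -
  define d where "d = a + b + 1 + 2 * real j"
  define M where "M = N - i"
  have M: "M > 0" "N = i + M" using \<open>i < N\<close> by (auto simp: M_def)
  have s: "N - 1 - i + 1 = M" "real (N - 1 - i) = real M - 1"
    using M by auto
  define P where "P = pochhammer (a + b + real j + real i + 1) M"
  have pos: "a + b + 1 + real l \<noteq> 0" for l
    using nz by (cases l) auto
  have P: "P \<noteq> 0"
  proof -
    have "a + b + real j + real i + 1 + real k \<noteq> 0" for k
      using pos[of "j + i + k"] by (simp add: add_ac)
    then show ?thesis
      by (auto simp: P_def pochhammer_eq_0_iff eq_neg_iff_add_eq_0)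
  qed
  have Dpos: "d + 2 * real i + real M \<noteq> 0"
    using nz(1) M by (simp add: d_def)
  have quot: "jacobi_quot a b (j + N) (N - 1 - i) =
      (d + 2 * real i) * pochhammer (b + real j + real i + 1) M / (real M * (d + 2 * real i + real M) * P)"
    unfolding jacobi_quot_def s P_def using M(2) by (simp add: d_def algebra_simps)
  have frac: "1 / (real N - real i) - 1 / (real N + d + real i)
      = (d + 2 * real i) / (real M * (d + 2 * real i + real M))"
    using M Dpos by (simp add: divide_simps algebra_simps)
  have bs: "pochhammer (b + real j + 1) N = pochhammer (b + real j + 1) i * pochhammer (b + real j + real i + 1) M"
    unfolding M(2) pochhammer_product' by (simp add: algebra_simps)
  have ds: "pochhammer d N = pochhammer d i * pochhammer (d + real i) M"
    unfolding M(2) pochhammer_product' ..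
  (* Both sides are pochhammer (a + b + j + i + 1) (j + M), split after j and after M factors. *)
  have cs: "pochhammer (real (j + i) + a + b + 1) j * pochhammer (d + real i) M
          = P * pochhammer (real (j + N) + a + b + 1) j"
    using pochhammer_product'[of "a + b + real j + real i + 1" j M] pochhammer_product'[of "a + b + real j + real i + 1" M j]
    by (simp add: P_def d_def M(2) algebra_simps)
  have coeff: "jacobi_shifted_coeff (j + l) a b j = (-1) ^ l / (fact j * fact l) *
      pochhammer (b + real j + 1) l * pochhammer (real (j + l) + a + b + 1) j" for l
  proof -
    have "(-1 :: real) ^ (j + l + j) = (-1) ^ l * ((-1) ^ j * (-1) ^ j)"
      by (simp only: power_add mult_ac)
    also have "\<dots> = (-1) ^ l"
      by (simp flip: power_mult_distrib)
    finally show ?thesis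
      by (simp add: jacobi_shifted_coeff_def binomial_fact)
  qed
  have gc: "(- d) gchoose l = (-1) ^ l / fact l * pochhammer d l" for l
    by (simp add: gbinomial_pochhammer)
  define R where "R = (d + 2 * real i) / (real M * (d + 2 * real i + real M))"
  define K :: real where "K = (-1) ^ i * (-1) ^ N / (fact j * fact i * fact N)"
  have "jacobi_quot a b (j + N) (N - 1 - i) * jacobi_shifted_coeff (j + i) a b j * ((- d) gchoose N)
     = R * K * pochhammer (b + real j + 1) N * pochhammer d i *
       (pochhammer (real (j + i) + a + b + 1) j * pochhammer (d + real i) M) / P"
    unfolding quot coeff gc bs ds R_def K_def by (simp add: mult_ac)
  also have "\<dots> = R * K * pochhammer (b + real j + 1) N * pochhammer d i * pochhammer (real (j + N) + a + b + 1) j"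
    unfolding cs using P by simp
  also have "\<dots> = jacobi_shifted_coeff (j + N) a b j * (((- d) gchoose i) * R)"
    unfolding coeff gc K_def by (simp add: mult_ac)
  finally show ?thesis
    unfolding R_def frac[symmetric] unfolding d_def .
qed

text \<open>
  Only the degrees \<open>m - s - 1 \<ge> j\<close> contribute to the coefficient of \<open>u\<^sup>j\<close>, which leaves \<open>N = m - j\<close>
  terms. The excluded value \<open>a + b = -1\<close> would make \<open>t N = (- d) gchoose N\<close> vanish for \<open>j = 0\<close>,
  and the identity is obtained by cancelling this factor.
\<close>

lemma jacobi_shifted_coeff_connection_generic:
  assumes "a + b > -2" "a + b \<noteq> -1" "m \<ge> 1"
  shows "jacobi_shifted_coeff m a b j *
      ((\<Sum>i<j. 1 / (real m + a + b + 1 + real i)) - (\<Sum>i<m. 1 / (real m + a + b + 1 + real i)))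
    = (\<Sum>s<m. jacobi_quot a b m s * jacobi_shifted_coeff (m - s - 1) a b j)"
proof (cases "j < m")
  case False
  then have "j = m \<or> m < j" by auto
  then show ?thesis
    using False by (auto simp: jacobi_shifted_coeff_eq_0 intro!: sum.neutral)
next
  case True
  define N where "N = m - j"
  have m: "m = j + N" and N: "N > 0" using True by (auto simp: N_def)
  define d where "d = a + b + 1 + 2 * real j"
  define t where "t i = (- d) gchoose i" for i
  have pos: "d + real l \<noteq> 0" for l
    using assms(1,2) by (cases "l = 0 \<and> j = 0") (auto simp: d_def)
  have posN: "real N + d + real l \<noteq> 0" for l
    using pos[of "N + l"] by (simp add: add_ac)
  have tN: "t N \<noteq> 0"
    using pos by (auto simp: t_def gbinomial_pochhammer pochhammer_eq_0_iff eq_neg_iff_add_eq_0)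
  have shift: "real m + a + b + 1 + real (j + i) = real N + d + real i" for i
    by (simp add: m d_def)
  have split: "(\<Sum>i<j + l. f i) = (\<Sum>i<j. f i) + (\<Sum>i<l. f (j + i))" for l and f :: "nat \<Rightarrow> real"
    by (induction l) auto
  have "(\<Sum>i<m. 1 / (real m + a + b + 1 + real i))
      = (\<Sum>i<j. 1 / (real m + a + b + 1 + real i)) + (\<Sum>i<N. 1 / (real N + d + real i))"
    unfolding shift[symmetric] m by (rule split)
  then have "t N * (jacobi_shifted_coeff m a b j *
      ((\<Sum>i<j. 1 / (real m + a + b + 1 + real i)) - (\<Sum>i<m. 1 / (real m + a + b + 1 + real i))))
    = jacobi_shifted_coeff m a b j * (- t N * (\<Sum>i<N. 1 / (real N + d + real i)))"
    by simp
  also have "- t N * (\<Sum>i<N. 1 / (real N + d + real i))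
    = (\<Sum>i<N. t i * (1 / (real N - real i) - 1 / (real N + d + real i)))"
    using sum_gbinomial_diff_inverse[of N "- d"] posN by (simp add: t_def)
  also have "jacobi_shifted_coeff m a b j * \<dots>
    = (\<Sum>i<N. t N * (jacobi_quot a b m (N - 1 - i) * jacobi_shifted_coeff (j + i) a b j))"
    unfolding sum_distrib_left
    using jacobi_shifted_coeff_ratio[OF assms(1,2), of _ N j]
    by (intro sum.cong) (auto simp: m t_def d_def mult_ac)
  also have "\<dots> = (\<Sum>s<N. t N * (jacobi_quot a b m s * jacobi_shifted_coeff (m - s - 1) a b j))"
    by (rule sum.reindex_bij_witness[of _ "\<lambda>s. N - 1 - s" "\<lambda>i. N - 1 - i"]) (auto simp: m)
  also have "\<dots> = (\<Sum>s<m. t N * (jacobi_quot a b m s * jacobi_shifted_coeff (m - s - 1) a b j))"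
    by (rule sum.mono_neutral_left) (auto simp: m jacobi_shifted_coeff_eq_0)
  finally show ?thesis
    using tN by (simp flip: sum_distrib_left)
qed

text \<open>
  At \<open>a + b = -1\<close> the quotient may degenerate to \<open>0 / 0\<close>, but \<open>jacobi_coeff\<close> is its limit in \<open>a\<close>,
  and the remaining parts of the generic identity are continuous there.
\<close>

lemma jacobi_shifted_coeff_connection:
  assumes "a > -1" "b > -1" "m \<ge> 1"
  shows "jacobi_shifted_coeff m a b j *
      ((\<Sum>i<j. 1 / (real m + a + b + 1 + real i)) - (\<Sum>i<m. 1 / (real m + a + b + 1 + real i)))
    = (\<Sum>s<m. jacobi_coeff a b m s * jacobi_shifted_coeff (m - s - 1) a b j)"
    (is "?L a = _")
proof -
  let ?R = "\<lambda>t. \<Sum>s<m. jacobi_quot t b m s * jacobi_shifted_coeff (m - s - 1) t b j"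
  have cont: "isCont (\<lambda>t. jacobi_shifted_coeff n t b j) a" for n
    unfolding jacobi_shifted_coeff_def pochhammer_prod by (intro continuous_intros)
  have nz: "real m + a + b + 1 + real i \<noteq> 0" for i
    using assms by linarith
  have "isCont ?L a"
    by (intro continuous_intros cont nz)
  then have "(?L \<longlongrightarrow> ?L a) (at a)"
    unfolding isCont_def .
  moreover have "\<forall>\<^sub>F t in at a. ?L t = ?R t"
  proof -
    have "\<forall>\<^sub>F t in at a. t \<noteq> -1 - b" by (rule eventually_neq_at_within)
    moreover have "\<forall>\<^sub>F t in at a. t > -1"
      using assms(1) by (rule order_tendstoD[OF tendsto_ident_at])
    ultimately show ?thesis
    proof eventually_elim
      case (elim t)
      with assms(2,3) show ?case
        by (intro jacobi_shifted_coeff_connection_generic) auto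
    qed
  qed
  ultimately have "(?R \<longlongrightarrow> ?L a) (at a)"
    by (rule Lim_transform_eventually)
  moreover have "(?R \<longlongrightarrow> (\<Sum>s<m. jacobi_coeff a b m s * jacobi_shifted_coeff (m - s - 1) a b j)) (at a)"
    using assms(1,2) cont unfolding isCont_def
    by (intro tendsto_sum tendsto_mult tendsto_jacobi_coeff) auto
  ultimately show ?thesis
    by (rule LIM_unique)
qed

section \<open>Parameter derivatives of Jacobi polynomials\<close>

lemma has_real_derivative_pochhammer:
  assumes "\<And>i. i < k \<Longrightarrow> z + real i \<noteq> 0"
  shows "((\<lambda>z. pochhammer z k) has_real_derivative pochhammer z k * (\<Sum>i<k. 1 / (z + real i))) (at z)"
  unfolding pochhammer_prod atLeast0LessThan using assms
  by (intro has_field_derivative_prod') (auto intro!: derivative_eq_intros)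

lemma has_real_derivative_jacobi_poly_fst:
  assumes "a > -1" "b > -1" "m \<ge> 1"
  shows "((\<lambda>t. poly (jacobi_poly m t b) x) has_real_derivative
     (\<Sum>s<m. 1 / (real m + real s + a + b + 1) * poly (jacobi_poly m a b) x)
     + (\<Sum>s<m. jacobi_coeff a b m s * poly (jacobi_poly (m - s - 1) a b) x)) (at a)"
proof -
  define H where "H k = (\<Sum>i<k. 1 / (real m + a + b + 1 + real i))" for k
  define u where "u = (1 + x) / 2"
  (* A common summation range for all degrees up to m. *)
  have expand: "poly (jacobi_poly n t c) x = (\<Sum>j\<le>m. jacobi_shifted_coeff n t c j * u ^ j)" if "n \<le> m" for n t c
    unfolding poly_jacobi_poly_shifted u_def using that
    by (intro sum.mono_neutral_left) (auto simp: jacobi_shifted_coeff_eq_0)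
  have "((\<lambda>t. jacobi_shifted_coeff m t b j) has_real_derivative jacobi_shifted_coeff m a b j * H j) (at a)" for j
  proof -
    have "real m + a + b + 1 + real i \<noteq> 0" for i
      using assms by linarith
    then have "((\<lambda>z. pochhammer z j) has_real_derivative pochhammer (real m + a + b + 1) j * H j)
      (at (real m + a + b + 1))"
      unfolding H_def by (intro has_real_derivative_pochhammer)
    then have "((\<lambda>t. pochhammer (real m + t + b + 1) j) has_real_derivative
        pochhammer (real m + a + b + 1) j * H j * 1) (at a)"
      by (rule DERIV_chain2) (auto intro!: derivative_eq_intros)
    from DERIV_cmult[OF this, of "(-1) ^ (m + j) / fact m * real (m choose j) * pochhammer (b + real j + 1) (m - j)"]
    show ?thesis
      unfolding jacobi_shifted_coeff_def by (simp only: mult.assoc mult_1_right)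
  qed
  then have "((\<lambda>t. \<Sum>j\<le>m. jacobi_shifted_coeff m t b j * u ^ j) has_real_derivative
     (\<Sum>j\<le>m. jacobi_shifted_coeff m a b j * H j * u ^ j)) (at a)"
    by (intro DERIV_sum DERIV_cmult_right)
  also have "(\<Sum>j\<le>m. jacobi_shifted_coeff m a b j * H j * u ^ j)
    = (\<Sum>j\<le>m. H m * (jacobi_shifted_coeff m a b j * u ^ j)) +
      (\<Sum>j\<le>m. (jacobi_shifted_coeff m a b j * (H j - H m)) * u ^ j)"
    unfolding sum.distrib[symmetric] by (intro sum.cong HOL.refl) (simp add: algebra_simps)
  also have "(\<Sum>j\<le>m. H m * (jacobi_shifted_coeff m a b j * u ^ j)) = H m * poly (jacobi_poly m a b) x"
    by (simp add: expand sum_distrib_left)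
  also have "(\<Sum>j\<le>m. (jacobi_shifted_coeff m a b j * (H j - H m)) * u ^ j)
     = (\<Sum>j\<le>m. \<Sum>s<m. jacobi_coeff a b m s * (jacobi_shifted_coeff (m - s - 1) a b j * u ^ j))"
    unfolding H_def jacobi_shifted_coeff_connection[OF assms]
    by (simp add: sum_distrib_right mult.assoc)
  also have "\<dots> = (\<Sum>s<m. jacobi_coeff a b m s * poly (jacobi_poly (m - s - 1) a b) x)"
    by (subst sum.swap) (simp add: expand sum_distrib_left)
  also have "H m * poly (jacobi_poly m a b) x =
      (\<Sum>s<m. 1 / (real m + real s + a + b + 1) * poly (jacobi_poly m a b) x)"
    unfolding H_def sum_distrib_right by (intro sum.cong) (simp_all add: add_ac)
  finally show ?thesis
    unfolding expand[OF order.refl, symmetric] .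
qed

text \<open>
  The reflection contributes \<open>(-1) ^ m\<close> from the degree \<open>m\<close> and \<open>(-1) ^ (m - s - 1)\<close> from the
  degree \<open>m - s - 1\<close>, which leaves the sign \<open>(-1) ^ (s + 1)\<close>.
\<close>

lemma has_real_derivative_jacobi_poly_snd:
  assumes "a > -1" "b > -1" "m \<ge> 1"
  shows "((\<lambda>t. poly (jacobi_poly m a t) x) has_real_derivative
     (\<Sum>s<m. 1 / (real m + real s + a + b + 1) * poly (jacobi_poly m a b) x)
     + (\<Sum>s<m. (-1) ^ (s + 1) * jacobi_coeff b a m s * poly (jacobi_poly (m - s - 1) a b) x)) (at b)"
proof -
  have reflect: "poly (jacobi_poly n a t) x = (-1) ^ n * poly (jacobi_poly n t a) (- x)" for n t
    using arg_cong[OF jacobi_poly_reflect[of n a t], of "\<lambda>p. poly p (- x)"] by (simp add: poly_pcompose)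
  have "((\<lambda>t. (-1) ^ m * poly (jacobi_poly m t a) (- x)) has_real_derivative
     (-1) ^ m * ((\<Sum>s<m. 1 / (real m + real s + b + a + 1) * poly (jacobi_poly m b a) (- x))
     + (\<Sum>s<m. jacobi_coeff b a m s * poly (jacobi_poly (m - s - 1) b a) (- x)))) (at b)"
    using assms by (intro DERIV_cmult has_real_derivative_jacobi_poly_fst)
  also have "(-1) ^ m * ((\<Sum>s<m. 1 / (real m + real s + b + a + 1) * poly (jacobi_poly m b a) (- x))
     + (\<Sum>s<m. jacobi_coeff b a m s * poly (jacobi_poly (m - s - 1) b a) (- x)))
     = (\<Sum>s<m. 1 / (real m + real s + a + b + 1) * poly (jacobi_poly m a b) x)
     + (\<Sum>s<m. (-1) ^ (s + 1) * jacobi_coeff b a m s * poly (jacobi_poly (m - s - 1) a b) x)"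
    unfolding distrib_left sum_distrib_left
  proof (intro arg_cong2[where f = "(+)"] sum.cong refl)
    fix s assume "s \<in> {..<m}"
    then have "m = s + 1 + (m - s - 1)"
      by simp
    then have sgn: "(-1 :: real) ^ m = (-1) ^ (s + 1) * (-1) ^ (m - s - 1)"
      by (metis power_add)
    show "(-1) ^ m * (jacobi_coeff b a m s * poly (jacobi_poly (m - s - 1) b a) (- x)) =
        (-1) ^ (s + 1) * jacobi_coeff b a m s * poly (jacobi_poly (m - s - 1) a b) x"
      unfolding reflect[of "m - s - 1" b] sgn by (simp only: mult_ac)
  next
    fix s
    show "(-1) ^ m * (1 / (real m + real s + b + a + 1) * poly (jacobi_poly m b a) (- x)) =
        1 / (real m + real s + a + b + 1) * poly (jacobi_poly m a b) x"
      unfolding reflect[of m b] by (simp add: add_ac)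
  qed
  finally show ?thesis by (simp add: reflect)
qed

section \<open>Jacobi polynomials on the square\<close>

theorem theorem2:
  fixes \<alpha> \<beta> \<gamma> \<delta> x y :: real
  assumes "\<alpha> > -1" and "\<beta> > -1" and "\<gamma> > -1" and "\<delta> > -1"
  shows
    "(\<forall>n k :: nat. n \<ge> k + 1 \<longrightarrow>
       ((\<lambda>a. jacobi_square n k a \<beta> \<gamma> \<delta> x y) has_real_derivative
         (\<Sum>s = 0..n - k - 1. 1 / (real n - real k + real s + \<alpha> + \<beta> + 1) *
            jacobi_square n k \<alpha> \<beta> \<gamma> \<delta> x y) +
         (\<Sum>s = 0..n - k - 1. jacobi_coeff \<alpha> \<beta> (n - k) s *
            jacobi_square (n - s - 1) k \<alpha> \<beta> \<gamma> \<delta> x y)) (at \<alpha>))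
   \<and> (\<forall>n k :: nat. n \<ge> k + 1 \<longrightarrow>
       ((\<lambda>b. jacobi_square n k \<alpha> b \<gamma> \<delta> x y) has_real_derivative
         (\<Sum>s = 0..n - k - 1. 1 / (real n - real k + real s + \<alpha> + \<beta> + 1) *
            jacobi_square n k \<alpha> \<beta> \<gamma> \<delta> x y) +
         (\<Sum>s = 0..n - k - 1. (-1) ^ (s + 1) * jacobi_coeff \<beta> \<alpha> (n - k) s *
            jacobi_square (n - s - 1) k \<alpha> \<beta> \<gamma> \<delta> x y)) (at \<beta>))
   \<and> (\<forall>n :: nat.
       ((\<lambda>a. jacobi_square n n a \<beta> \<gamma> \<delta> x y) has_real_derivative 0) (at \<alpha>) \<and>
       ((\<lambda>b. jacobi_square n n \<alpha> b \<gamma> \<delta> x y) has_real_derivative 0) (at \<beta>))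
   \<and> (\<forall>n k :: nat. n \<ge> k \<and> k \<ge> 1 \<longrightarrow>
       ((\<lambda>c. jacobi_square n k \<alpha> \<beta> c \<delta> x y) has_real_derivative
         (\<Sum>s = 0..k - 1. 1 / (\<gamma> + \<delta> + real k + real s + 1) *
            jacobi_square n k \<alpha> \<beta> \<gamma> \<delta> x y) +
         (\<Sum>s = 0..k - 1. jacobi_coeff \<gamma> \<delta> k s *
            jacobi_square (n - s - 1) (k - s - 1) \<alpha> \<beta> \<gamma> \<delta> x y)) (at \<gamma>))
   \<and> (\<forall>n k :: nat. n \<ge> k \<and> k \<ge> 1 \<longrightarrow>
       ((\<lambda>d. jacobi_square n k \<alpha> \<beta> \<gamma> d x y) has_real_derivative
         (\<Sum>s = 0..k - 1. 1 / (\<gamma> + \<delta> + real k + real s + 1) *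
            jacobi_square n k \<alpha> \<beta> \<gamma> \<delta> x y) +
         (\<Sum>s = 0..k - 1. (-1) ^ (s + 1) * jacobi_coeff \<delta> \<gamma> k s *
            jacobi_square (n - s - 1) (k - s - 1) \<alpha> \<beta> \<gamma> \<delta> x y)) (at \<delta>))
   \<and> (\<forall>n :: nat.
       ((\<lambda>c. jacobi_square n 0 \<alpha> \<beta> c \<delta> x y) has_real_derivative 0) (at \<gamma>) \<and>
       ((\<lambda>d. jacobi_square n 0 \<alpha> \<beta> \<gamma> d x y) has_real_derivative 0) (at \<delta>))"
proof (intro conjI allI impI)
  fix n k :: nat
  assume n: "n \<ge> k + 1"
  then have m: "n - k \<ge> 1" "{0..n - k - 1} = {..<n - k}" "real n - real k = real (n - k)"
    by auto
  have deg: "n - s - 1 - k = n - k - s - 1" for s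
    by simp
  from DERIV_cmult_right[OF has_real_derivative_jacobi_poly_fst[OF assms(1,2) m(1), of x], of "poly (jacobi_poly k \<gamma> \<delta>) y"]
  show "((\<lambda>a. jacobi_square n k a \<beta> \<gamma> \<delta> x y) has_real_derivative
         (\<Sum>s = 0..n - k - 1. 1 / (real n - real k + real s + \<alpha> + \<beta> + 1) *
            jacobi_square n k \<alpha> \<beta> \<gamma> \<delta> x y) +
         (\<Sum>s = 0..n - k - 1. jacobi_coeff \<alpha> \<beta> (n - k) s *
            jacobi_square (n - s - 1) k \<alpha> \<beta> \<gamma> \<delta> x y)) (at \<alpha>)"
    unfolding jacobi_square_def m(2,3) deg by (simp only: distrib_right sum_distrib_right mult.assoc)
  from DERIV_cmult_right[OF has_real_derivative_jacobi_poly_snd[OF assms(1,2) m(1), of x], of "poly (jacobi_poly k \<gamma> \<delta>) y"]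
  show "((\<lambda>b. jacobi_square n k \<alpha> b \<gamma> \<delta> x y) has_real_derivative
         (\<Sum>s = 0..n - k - 1. 1 / (real n - real k + real s + \<alpha> + \<beta> + 1) *
            jacobi_square n k \<alpha> \<beta> \<gamma> \<delta> x y) +
         (\<Sum>s = 0..n - k - 1. (-1) ^ (s + 1) * jacobi_coeff \<beta> \<alpha> (n - k) s *
            jacobi_square (n - s - 1) k \<alpha> \<beta> \<gamma> \<delta> x y)) (at \<beta>)"
    unfolding jacobi_square_def m(2,3) deg by (simp only: distrib_right sum_distrib_right mult.assoc)
next
  fix n k :: nat
  assume "n \<ge> k \<and> k \<ge> 1"
  then have n: "n \<ge> k" and k: "k \<ge> 1" "{0..k - 1} = {..<k}"
    by auto
  have deg: "n - s - 1 - (k - s - 1) = n - k" if "s \<in> {..<k}" for s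
    using that n by auto
  have args: "\<gamma> + \<delta> + real k + real s + 1 = real k + real s + \<gamma> + \<delta> + 1" for s
    by simp
  from DERIV_cmult[OF has_real_derivative_jacobi_poly_fst[OF assms(3,4) k(1), of y], of "poly (jacobi_poly (n - k) \<alpha> \<beta>) x"]
  show "((\<lambda>c. jacobi_square n k \<alpha> \<beta> c \<delta> x y) has_real_derivative
         (\<Sum>s = 0..k - 1. 1 / (\<gamma> + \<delta> + real k + real s + 1) *
            jacobi_square n k \<alpha> \<beta> \<gamma> \<delta> x y) +
         (\<Sum>s = 0..k - 1. jacobi_coeff \<gamma> \<delta> k s *
            jacobi_square (n - s - 1) (k - s - 1) \<alpha> \<beta> \<gamma> \<delta> x y)) (at \<gamma>)"
    unfolding jacobi_square_def k(2) args
    by (simp only: distrib_left sum_distrib_left mult_ac deg cong: sum.cong)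
  from DERIV_cmult[OF has_real_derivative_jacobi_poly_snd[OF assms(3,4) k(1), of y], of "poly (jacobi_poly (n - k) \<alpha> \<beta>) x"]
  show "((\<lambda>d. jacobi_square n k \<alpha> \<beta> \<gamma> d x y) has_real_derivative
         (\<Sum>s = 0..k - 1. 1 / (\<gamma> + \<delta> + real k + real s + 1) *
            jacobi_square n k \<alpha> \<beta> \<gamma> \<delta> x y) +
         (\<Sum>s = 0..k - 1. (-1) ^ (s + 1) * jacobi_coeff \<delta> \<gamma> k s *
            jacobi_square (n - s - 1) (k - s - 1) \<alpha> \<beta> \<gamma> \<delta> x y)) (at \<delta>)"
    unfolding jacobi_square_def k(2) args
    by (simp only: distrib_left sum_distrib_left mult_ac deg cong: sum.cong)
qed (simp_all add: jacobi_square_def jacobi_poly_0)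

end
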